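(* Let $G=(\Lambda,\{S^i\}_{i\in\Lambda},\{F^i\}_{i\in\Lambda})$ be a multiobjective interval-valued noncooperative game with $\Lambda=\{1,\dots,l\}$, strategy sets $S^i=\{u\in\mathbb{R}^n:g^i_j(u)\le0,\ j\in J\}$, $J=\{1,\dots,p\}$, and loss functions $F^i=(F^i_1,\dots,F^i_m)$, $K=\{1,\dots,m\}$. Let $\varepsilon=(\varepsilon_1,\dots,\varepsilon_m)\in\mathbb{R}^m_+\setminus\{0\}$ and $\overline{u}=(\overline{u}_1,\dots,\overline{u}_l)\in\widehat{S}=\prod_{i\in\Lambda}S^i$, where $F^i_k(\cdot,\overline{u}_{-i})$ and $g^i_j$ are locally Lipschitz continuous on $\mathbb{R}^n$ for all $k\in K$, $i\in\Lambda$, $j\in J$. Suppose that for every $i\in\Lambda$ there exist $\lambda^i\in\mathbb{R}^m_+$ with $\sum_{k\in K}\lambda^i_k=1$ and $\mu^i\in\mathbb{R}^p_+$ such that $$0\in\sum_{k\in K}\lambda^i_k\partial^0 F^i_k(\overline{u}_i,\overline{u}_{-i})+\sum_{j\in I(\overline{u}_i)}\mu^i_j\partial^0 g^i_j(\overline{u}_i)+\sum_{k\in K}\lambda^i_k\varepsilon_k \mathbb{B}^n,\qquad \mu^i_jg^i_j(\overline{u}_i)=0\ \ \forall j\in J.$$ Assume that $(F^i(\cdot,\overline{u}_{-i}),g^i_J)$ is generalized convex at $\overline{u}_i\in S^i$ for all $i\in\Lambda$. Then $\overline{u}$ is a weak $\varepsilon$-quasi Nash equilibrium of $G$.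
   Context: $\mathcal{I}$ is the set of all compact intervals $[\underline q,\overline q]$ with $\underline q\le\overline q$ real. For $Q=[\underline q,\overline q]\in\mathcal I$ put $q^c=\frac{\underline q+\overline q}{2}$ and $q^w=\frac{\overline q-\underline q}{2}$. Addition: $[\underline q,\overline q]+[\underline r,\overline r]=[\underline q+\underline r,\overline q+\overline r]$. Order: $Q\prec_{CW}R$ iff $q^c<r^c$ and $q^w<r^w$. $\mathbb{R}^m_+$ is the nonnegative orthant; $\mathbb{B}^n$ is the closed unit ball of $\mathbb{R}^n$; $\mathrm{co}$ denotes convex hull. An interval-valued function $f=[\underline f,\overline f]:\mathbb{R}^n\to\mathcal I$ is locally Lipschitz continuous if every point has a neighbourhood $U$ and $L>0$ with $\max\{|\underline f(u_1)-\underline f(u_2)|,|\overline f(u_1)-\overline f(u_2)|\}\le L\|u_1-u_2\|$ for $u_1,u_2\in U$. Write $f^c=\frac{\underline f+\overline f}{2}$, $f^w=\frac{\overline f-\underline f}{2}$. For locally Lipschitz $\psi:\mathbb{R}^n\to\mathbb{R}$, $\psi^0(z;w)=\limsup_{u\to z,\,t\to0^+}\frac{\psi(u+tw)-\psi(u)}{t}$ and $\partial^0\psi(z)=\{z^*:\langle z^*,w\rangle\le\psi^0(z;w)\ \forall w\in\mathbb{R}^n\}$ (Clarke gradient). For locally Lipschitz interval-valued $f$, $\partial^0f(u):=\mathrm{co}(\partial^0f^c(u)\cup\partial^0f^w(u))$. Game: $g^i_j:\mathbb{R}^n\to\mathbb{R}$; each $F^i_k$ is an $\mathcal I$-valued function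 of strategy profiles $u=(u_1,\dots,u_l)$, with center $F^{ic}_k$ and half-width $F^{iw}_k$. For a profile $\overline u$, $\overline u_{-i}$ is $\overline u$ with the $i$-th component removed, and $(u_i,\overline u_{-i})$ is $\overline u$ with the $i$-th component replaced by $u_i$. For fixed $\overline u_{-i}$, $F^i_k(\cdot,\overline u_{-i})$ is regarded as defined on all of $\mathbb{R}^n$, and $\partial^0F^i_k(x,\overline u_{-i})$ is the gradient at $x$ of $F^i_k(\cdot,\overline u_{-i})$. For $x\in S^i$, $I(x):=\{j\in J:g^i_j(x)=0\}$; a sum over an empty index set is $\{0\}$. $(F^i(\cdot,\overline u_{-i}),g^i_J)$ is generalized convex at $x_0^i\in S^i$ if for any $x^i\in S^i$, any $\widehat x^i_k\in\partial^0F^i_k(x^i_0,\overline u_{-i})$ ($k\in K$) and any $\widehat z^i_j\in\partial^0g^i_j(x^i_0)$ ($j\in J$), there exists $v^i\in\mathbb{R}^n$ such that $\langle\widehat x^i_k,v^i\rangle\le F^{ic}_k(x^i,\overline u_{-i})-F^{ic}_k(x^i_0,\overline u_{-i})+F^{iw}_k(x^i,\overline u_{-i})-F^{iw}_k(x^i_0,\overline u_{-i})$ for all $k\in K$, $\langle\widehat z^i_j,v^i\rangle\le g^i_j(x^i)-g^i_j(x^i_0)$ for all $j\in J$, and $\langle y^*,v^i\rangle\le\|x^i-x^i_0\|$ for all $y^*\in\mathbb{B}^n$. $\overline u\in\widehat S$ is a weak $\varepsilon$-quasi Nash equilibrium if for every $i\in\Lambda$ there is no $y_i\in S^i$ with $F^i_k(y_i,\overline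 u_{-i})+[0,\varepsilon_k\|\overline u_i-y_i\|]\prec_{CW}F^i_k(\overline u)$ for all $k\in K$. *)

theory Defs
  imports "HOL-Analysis.Analysis" "HOL-Library.Interval"
begin

definition center :: "real interval \<Rightarrow> real" where
  "center Q = (lower Q + upper Q) / 2"

definition halfwidth :: "real interval \<Rightarrow> real" where
  "halfwidth Q = (upper Q - lower Q) / 2"

definition prec_CW :: "real interval \<Rightarrow> real interval \<Rightarrow> bool"
    (infix \<open>\<prec>\<^sub>C\<^sub>W\<close> 50) where
  "Q \<prec>\<^sub>C\<^sub>W R \<longleftrightarrow> center Q < center R \<and> halfwidth Q < halfwidth R"

definition nonneg_orthant :: "(real ^ 'm) set" where
  "nonneg_orthant = {x. \<forall>k. 0 \<le> x $ k}"

definition locally_lipschitz :: "('a::metric_space \<Rightarrow> real) \<Rightarrow> bool" where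
  "locally_lipschitz \<psi> \<longleftrightarrow>
     (\<forall>z. \<exists>U L. open U \<and> z \<in> U \<and> 0 < L \<and> L-lipschitz_on U \<psi>)"

definition interval_locally_lipschitz ::
    "('a::real_normed_vector \<Rightarrow> real interval) \<Rightarrow> bool" where
  "interval_locally_lipschitz f \<longleftrightarrow>
     (\<forall>z. \<exists>U L. open U \<and> z \<in> U \<and> 0 < L \<and>
        (\<forall>u1\<in>U. \<forall>u2\<in>U.
           max \<bar>lower (f u1) - lower (f u2)\<bar> \<bar>upper (f u1) - upper (f u2)\<bar>
             \<le> L * norm (u1 - u2)))"

text \<open>The limit superior is taken in the extended reals, where it always exists; it is finite
  for locally Lipschitz \<open>\<psi>\<close>. The base point \<open>u\<close> may equal \<open>z\<close>, hence \<^term>\<open>nhds z\<close> and not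
  \<^term>\<open>at z\<close>.\<close>

definition clarke_deriv :: "('a::real_normed_vector \<Rightarrow> real) \<Rightarrow> 'a \<Rightarrow> 'a \<Rightarrow> ereal" where
  "clarke_deriv \<psi> z w =
     Limsup (nhds z \<times>\<^sub>F at_right 0) (\<lambda>(u, t). ereal ((\<psi> (u + t *\<^sub>R w) - \<psi> u) / t))"

definition clarke_gradient :: "('a::real_inner \<Rightarrow> real) \<Rightarrow> 'a \<Rightarrow> 'a set" where
  "clarke_gradient \<psi> z = {z'. \<forall>w. ereal (z' \<bullet> w) \<le> clarke_deriv \<psi> z w}"

definition interval_clarke_gradient ::
    "('a::real_inner \<Rightarrow> real interval) \<Rightarrow> 'a \<Rightarrow> 'a set" where
  "interval_clarke_gradient f u =
     convex hull (clarke_gradient (\<lambda>x. center (f x)) u \<union>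
                  clarke_gradient (\<lambda>x. halfwidth (f x)) u)"

text \<open>The players, the components of the losses and the constraints are indexed by finite types
  \<open>'l\<close>, \<open>'m\<close> and \<open>'p\<close>. A strategy profile is a function \<open>u\<close> from players to strategies, and
  \<open>u(i := x)\<close> stands for the profile whose \<open>i\<close>-th component is replaced by \<open>x\<close>.\<close>

definition strategy_set :: "('p::finite \<Rightarrow> real ^ 'n \<Rightarrow> real) \<Rightarrow> (real ^ 'n) set" where
  "strategy_set g = {u. \<forall>j. g j u \<le> 0}"

definition active_set :: "('p::finite \<Rightarrow> real ^ 'n \<Rightarrow> real) \<Rightarrow> real ^ 'n \<Rightarrow> 'p set" where
  "active_set g x = {j. g j x = 0}"

text \<open>Here \<open>f k\<close> is the \<open>k\<close>-th loss of one player as a function of that player's own strategy,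
  the strategies of the other players being fixed.\<close>

definition generalized_convex_at ::
    "('m::finite \<Rightarrow> real ^ 'n \<Rightarrow> real interval) \<Rightarrow> ('p::finite \<Rightarrow> real ^ 'n \<Rightarrow> real)
       \<Rightarrow> real ^ 'n \<Rightarrow> bool" where
  "generalized_convex_at f g x0 \<longleftrightarrow>
     (\<forall>x\<in>strategy_set g. \<forall>\<xi> \<zeta>.
        (\<forall>k. \<xi> k \<in> interval_clarke_gradient (f k) x0) \<longrightarrow>
        (\<forall>j. \<zeta> j \<in> clarke_gradient (g j) x0) \<longrightarrow>
        (\<exists>v. (\<forall>k. \<xi> k \<bullet> v \<le> center (f k x) - center (f k x0)
                              + halfwidth (f k x) - halfwidth (f k x0)) \<and>
             (\<forall>j. \<zeta> j \<bullet> v \<le> g j x - g j x0) \<and>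
             (\<forall>y\<in>cball 0 1. y \<bullet> v \<le> norm (x - x0))))"

text \<open>\<open>Ivl a b\<close> is the interval from \<open>a\<close> to \<open>b\<close> provided \<open>a \<le> b\<close>, which holds below because
  \<open>\<epsilon>\<close> is meant to lie in the nonnegative orthant.\<close>

definition weak_quasi_nash ::
    "('l::finite \<Rightarrow> (real ^ 'n) set) \<Rightarrow>
     ('l \<Rightarrow> 'm::finite \<Rightarrow> ('l \<Rightarrow> real ^ 'n) \<Rightarrow> real interval) \<Rightarrow>
     real ^ 'm \<Rightarrow> ('l \<Rightarrow> real ^ 'n) \<Rightarrow> bool" where
  "weak_quasi_nash S F \<epsilon> u \<longleftrightarrow>
     (\<forall>i. u i \<in> S i) \<and>
     (\<forall>i. \<not> (\<exists>y\<in>S i. \<forall>k.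
        F i k (u(i := y)) + Ivl 0 (\<epsilon> $ k * norm (u i - y)) \<prec>\<^sub>C\<^sub>W F i k u))"

end

theory Submission
  imports Defs
begin

text \<open>
  If \<open>y\<close> were a profitable deviation of player \<open>i\<close>, adding the center and half-width inequalities
  would give a decrease of more than \<open>\<epsilon>\<^sub>k \<parallel>u\<^sub>i - y\<parallel>\<close> in center plus half-width for every \<open>k\<close>.
  Pairing the stationarity relation with the vector \<open>v\<close> of generalized convexity then gives \<open>0 < 0\<close>.
  Generalized convexity also asks for Clarke gradients of the inactive constraints, so one needs that
  the Clarke gradient of a locally Lipschitz function is nonempty; this is a finite-dimensional
  Hahn-Banach argument, separating the origin from the strict epigraph of the Clarke derivative.
\<close>

text \<open>The filter of the limsup in \<open>clarke_deriv\<close>. Eventual strict bounds along it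
  replace that extended-real limsup by real inequalities.\<close>

abbreviation base_step_filter :: "'a::real_normed_vector \<Rightarrow> ('a \<times> real) filter" where
  "base_step_filter z \<equiv> nhds z \<times>\<^sub>F at_right 0"

abbreviation diff_quotient :: "('a::real_normed_vector \<Rightarrow> real) \<Rightarrow> 'a \<Rightarrow> 'a \<times> real \<Rightarrow> real" where
  "diff_quotient \<psi> w \<equiv> \<lambda>(u, t). (\<psi> (u + t *\<^sub>R w) - \<psi> u) / t"

lemma base_step_filter_nontrivial: "base_step_filter z \<noteq> bot"
  by (simp add: prod_filter_eq_bot nhds_neq_bot)

text \<open>The endpoint of a short step tends to \<open>z\<close> together with its base point, so
  it stays in a Lipschitz neighbourhood and may itself serve as a new base point.\<close>

lemma filterlim_base_step: "filterlim (\<lambda>(u, t). u + t *\<^sub>R w) (nhds z) (base_step_filter z)"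
proof -
  have "filterlim snd (nhds 0) (base_step_filter z)"
    by (rule filterlim_mono[OF filterlim_snd at_within_le_nhds order_refl])
  then have "filterlim (\<lambda>x. fst x + snd x *\<^sub>R w) (nhds (z + 0 *\<^sub>R w)) (base_step_filter z)"
    by (intro tendsto_add tendsto_scaleR tendsto_const filterlim_fst)
  then show ?thesis by (simp add: case_prod_beta')
qed

lemma eventually_step_pos: "eventually (\<lambda>x. snd x > 0) (base_step_filter z)"
  by (rule eventually_compose_filterlim[OF _ filterlim_snd])
     (simp add: eventually_at_right_less)

text \<open>Both ends of a short step lie in one Lipschitz neighbourhood, which bounds the quotient
  by \<open>L * norm w\<close>. Hence some bound exists over each direction, which later excludes a
  vertical separating hyperplane.\<close>

lemma diff_quotient_bounded:
  assumes "locally_lipschitz \<psi>"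
  shows "\<exists>r. eventually (\<lambda>x. diff_quotient \<psi> w x < r) (base_step_filter z)"
proof -
  obtain U L where U: "open U" "z \<in> U" and L: "L-lipschitz_on U \<psi>"
    using assms unfolding locally_lipschitz_def by metis
  have "eventually (\<lambda>x. x \<in> U) (nhds z)" using U by (rule eventually_nhds_in_open)
  note ev = eventually_compose_filterlim[OF this]
  have "eventually (\<lambda>x. diff_quotient \<psi> w x < L * norm w + 1) (base_step_filter z)"
    using ev[OF filterlim_fst] ev[OF filterlim_base_step[of w]] eventually_step_pos[of z]
  proof eventually_elim
    case (elim x)
    obtain u t where x: "x = (u, t)" by (cases x)
    have "\<psi> (u + t *\<^sub>R w) - \<psi> u \<le> L * dist (u + t *\<^sub>R w) u"
      using lipschitz_onD[OF L, of "u + t *\<^sub>R w" u] elim by (auto simp: x dist_real_def)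
    also have "\<dots> = L * norm w * t" using elim by (simp add: x dist_norm)
    finally have "diff_quotient \<psi> w x \<le> L * norm w"
      using elim by (simp add: x divide_le_eq)
    then show ?case by simp
  qed
  then show ?thesis ..
qed

text \<open>The set is the epigraph of the Clarke derivative up to boundary points. A step along a
  convex combination splits into two successive steps; the second starts at a shifted point, which
  is harmless because the base point varies in the limsup.\<close>

lemma convex_diff_quotient_bounds:
  "convex {(w, r). eventually (\<lambda>x. diff_quotient \<psi> w x < r) (base_step_filter z)}"
  (is "convex ?E")
  unfolding convex_alt
proof (intro ballI allI impI)
  fix p q :: "'a \<times> real" and s :: real
  assume pq: "p \<in> ?E" "q \<in> ?E" and s: "0 \<le> s \<and> s \<le> 1"
  obtain w1 r1 w2 r2 where p: "p = (w1, r1)" and q: "q = (w2, r2)" by (cases p, cases q)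
  show "(1 - s) *\<^sub>R p + s *\<^sub>R q \<in> ?E"
  \<comment> \<open>At the endpoints one of the rescaled step lengths would vanish and leave
    \<open>at_right 0\<close>.\<close>
  proof (cases "s = 0 \<or> s = 1")
    case True
    then show ?thesis using pq by auto
  next
    case False
    define a where "a = 1 - s"
    have pos: "0 < a" "0 < s" using s False by (auto simp: a_def)
    have step: "filterlim (\<lambda>x. c * snd x) (at_right 0) (base_step_filter z)" if "0 < c" for c :: real
      using that by (intro filterlim_times_pos[OF filterlim_snd]) auto
    have e1: "eventually (\<lambda>x. diff_quotient \<psi> w1 (fst x, a * snd x) < r1) (base_step_filter z)"
      using pq(1) unfolding p
      by (intro eventually_compose_filterlim[OF _ filterlim_Pair[OF filterlim_fst step[OF pos(1)]]])
         simp
    have base: "filterlim (\<lambda>x. fst x + snd x *\<^sub>R a *\<^sub>R w1) (nhds z) (base_step_filter z)"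
      using filterlim_base_step[of "a *\<^sub>R w1" z] by (simp add: case_prod_beta')
    \<comment> \<open>The second partial step begins where the first one, of length
      \<open>a * snd x\<close> along \<open>w1\<close>, has ended.\<close>
    have e2: "eventually (\<lambda>x. diff_quotient \<psi> w2 (fst x + snd x *\<^sub>R a *\<^sub>R w1, s * snd x) < r2)
                (base_step_filter z)"
      using pq(2) unfolding q
      by (intro eventually_compose_filterlim[OF _ filterlim_Pair[OF base step[OF pos(2)]]]) simp
    have "eventually (\<lambda>x. diff_quotient \<psi> (a *\<^sub>R w1 + s *\<^sub>R w2) x < a * r1 + s * r2)
            (base_step_filter z)"
      using e1 e2 eventually_step_pos[of z]
    proof eventually_elim
      case (elim x)
      obtain u t where x: "x = (u, t)" by (cases x)
      have t: "0 < t" using elim by (simp add: x)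
      have "\<psi> (u + t *\<^sub>R a *\<^sub>R w1) - \<psi> u < r1 * (a * t)"
        using elim(1) t pos by (simp add: x divide_less_eq mult.commute)
      moreover have "\<psi> (u + t *\<^sub>R a *\<^sub>R w1 + t *\<^sub>R s *\<^sub>R w2) - \<psi> (u + t *\<^sub>R a *\<^sub>R w1) < r2 * (s * t)"
        using elim(2) t pos by (simp add: x divide_less_eq mult.commute)
      \<comment> \<open>The value at the intermediate point cancels when the two increments are
        added.\<close>
      ultimately have "\<psi> (u + t *\<^sub>R (a *\<^sub>R w1 + s *\<^sub>R w2)) - \<psi> u < (a * r1 + s * r2) * t"
        by (simp add: algebra_simps)
      then show ?case using t by (simp add: x divide_less_eq)
    qed
    then show ?thesis by (simp add: p q a_def)
  qed
qed

lemma clarke_gradient_nonempty: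
  fixes \<psi> :: "'a::euclidean_space \<Rightarrow> real"
  assumes "locally_lipschitz \<psi>"
  shows "clarke_gradient \<psi> z \<noteq> {}"
proof -
  define E where "E = {(w, r). eventually (\<lambda>x. diff_quotient \<psi> w x < r) (base_step_filter z)}"
  have E_iff: "(w, r) \<in> E \<longleftrightarrow> eventually (\<lambda>x. diff_quotient \<psi> w x < r) (base_step_filter z)" for w r
    by (simp add: E_def)
  have "convex E" unfolding E_def by (rule convex_diff_quotient_bounds)
  \<comment> \<open>In direction 0 the quotient is constantly 0, and the filter is
    nontrivial.\<close>
  have zero_iff: "(0, r) \<in> E \<longleftrightarrow> 0 < r" for r
    by (simp add: E_iff case_prod_beta' base_step_filter_nontrivial)
  have "0 \<notin> E" using zero_iff[of 0] unfolding zero_prod_def by blast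
  then obtain c where c: "c \<noteq> 0" "\<And>p. p \<in> E \<Longrightarrow> 0 \<le> c \<bullet> p"
    using separating_hyperplane_set_0[OF \<open>convex E\<close>] by blast
  obtain a b where ab: "c = (a, b)" by (cases c)
  have sep: "0 \<le> a \<bullet> w + b * r" if "(w, r) \<in> E" for w r
    using c(2)[OF that] by (simp add: ab)
  have "0 \<le> b" using sep[of 0 1] zero_iff[of 1] by simp
  \<comment> \<open>A vertical hyperplane is impossible: testing over the direction
    \<open>- a\<close> would force \<open>a = 0\<close>, hence \<open>c = 0\<close>.\<close>
  moreover have "b \<noteq> 0"
  proof
    assume b: "b = 0"
    have "\<exists>r. (- a, r) \<in> E" unfolding E_iff by (rule diff_quotient_bounded[OF assms])
    then obtain r where "(- a, r) \<in> E" ..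
    then have "a \<bullet> a \<le> 0" using sep[of "- a" r] b by simp
    then have "a = 0" using inner_gt_zero_iff[of a] by linarith
    then show False using c(1) b ab by (simp add: prod_eq_iff)
  qed
  ultimately have b: "0 < b" by simp
  \<comment> \<open>Dividing the normal \<open>(a, b)\<close> by \<open>b\<close> turns the
    hyperplane into the graph of a linear minorant with gradient \<open>- a / b\<close>. It suffices
    to compare with every \<open>y\<close> above the Clarke derivative; a finite such
    \<open>y\<close> gives a point of \<open>E\<close>.\<close>
  have "ereal ((- (1 / b) *\<^sub>R a) \<bullet> w) \<le> clarke_deriv \<psi> z w" for w
  proof (rule dense_ge)
    fix y assume y: "clarke_deriv \<psi> z w < y"
    show "ereal ((- (1 / b) *\<^sub>R a) \<bullet> w) \<le> y"
    proof (cases y)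
      case (real r)
      have "eventually (\<lambda>(u, t). ereal ((\<psi> (u + t *\<^sub>R w) - \<psi> u) / t) < y) (base_step_filter z)"
        using Limsup_lessD[OF y[unfolded clarke_deriv_def]] by (simp add: case_prod_beta')
      then have "(w, r) \<in> E" by (simp add: E_iff real case_prod_beta')
      then have "0 \<le> a \<bullet> w + b * r" by (rule sep)
      then have "- (a \<bullet> w) / b \<le> r" using b by (simp add: field_simps)
      then show ?thesis by (simp add: real)
    qed (use y in auto)
  qed
  then show ?thesis unfolding clarke_gradient_def ex_in_conv[symmetric] mem_Collect_eq by (intro exI allI)
qed

lemma upper_Ivl: "upper (Ivl a b) = b"
  by (simp add: upper.rep_eq Ivl.rep_eq)

lemma center_add_halfwidth: "center Q + halfwidth Q = upper Q"
  unfolding center_def halfwidth_def add_divide_distrib diff_divide_distrib by linarith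

text \<open>Center plus half-width is the upper endpoint, which is additive; adding the two
  inequalities of the order therefore compares upper endpoints.\<close>

lemma prec_CW_add_Ivl_zero:
  assumes "Q + Ivl 0 a \<prec>\<^sub>C\<^sub>W R"
  shows "center Q + halfwidth Q + a < center R + halfwidth R"
proof -
  have "center (Q + Ivl 0 a) + halfwidth (Q + Ivl 0 a) < center R + halfwidth R"
    using assms by (intro add_strict_mono) (simp_all only: prec_CW_def)
  then show ?thesis by (simp add: center_add_halfwidth upper_Ivl)
qed

text \<open>Replaces each set sum in the stationarity relation by a concrete choice of summands that
  can be paired with \<open>v\<close>.\<close>

lemma sum_scaled_sets_elim:
  fixes X :: "'i \<Rightarrow> 'a::real_vector set"
  assumes "finite I" "x \<in> (\<Sum>i\<in>I. (*\<^sub>R) (c i) ` X i)"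
  obtains \<xi> where "\<And>i. i \<in> I \<Longrightarrow> \<xi> i \<in> X i" "x = (\<Sum>i\<in>I. c i *\<^sub>R \<xi> i)"
proof -
  obtain s where s: "x = sum s I" "\<forall>i\<in>I. s i \<in> (*\<^sub>R) (c i) ` X i"
    using assms(2) unfolding set_sum_alt[OF assms(1)] by blast
  then have "\<forall>i\<in>I. \<exists>e. e \<in> X i \<and> s i = c i *\<^sub>R e" by blast
  then obtain \<xi> where \<xi>: "\<forall>i\<in>I. \<xi> i \<in> X i \<and> s i = c i *\<^sub>R \<xi> i"
    unfolding bchoice_iff by blast
  have "x = (\<Sum>i\<in>I. c i *\<^sub>R \<xi> i)" using s(1) \<xi> by simp
  with \<xi> show ?thesis by (intro that[of \<xi>]) simp_all
qed

theorem theorem5p3: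
  fixes g :: "'l::finite \<Rightarrow> 'p::finite \<Rightarrow> real ^ 'n \<Rightarrow> real"
    and F :: "'l \<Rightarrow> 'm::finite \<Rightarrow> ('l \<Rightarrow> real ^ 'n) \<Rightarrow> real interval"
    and S :: "'l \<Rightarrow> (real ^ 'n) set"
    and \<epsilon> :: "real ^ 'm"
    and ubar :: "'l \<Rightarrow> real ^ 'n"
  assumes S_eq: "\<And>i. S i = strategy_set (g i)"
    and eps: "\<epsilon> \<in> nonneg_orthant - {0}"
    and ubar: "\<And>i. ubar i \<in> S i"
    and F_lipschitz: "\<And>i k. interval_locally_lipschitz (\<lambda>x. F i k (ubar(i := x)))"
    and g_lipschitz: "\<And>i j. locally_lipschitz (g i j)"
    and KKT: "\<And>i. \<exists>lam\<in>nonneg_orthant :: (real ^ 'm) set. \<exists>mu\<in>nonneg_orthant :: (real ^ 'p) set.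
        (\<Sum>k\<in>UNIV. lam $ k) = 1 \<and>
        0 \<in> (\<Sum>k\<in>UNIV. (*\<^sub>R) (lam $ k) ` interval_clarke_gradient (\<lambda>x. F i k (ubar(i := x))) (ubar i))
            + (\<Sum>j\<in>active_set (g i) (ubar i). (*\<^sub>R) (mu $ j) ` clarke_gradient (g i j) (ubar i))
            + (\<Sum>k\<in>UNIV. (*\<^sub>R) (lam $ k * \<epsilon> $ k) ` cball 0 1) \<and>
        (\<forall>j. mu $ j * g i j (ubar i) = 0)"
    and gen_convex: "\<And>i. generalized_convex_at (\<lambda>k x. F i k (ubar(i := x))) (g i) (ubar i)"
  shows "weak_quasi_nash S F \<epsilon> ubar"
proof -
  have no_deviation: False
    if y: "y \<in> S i"
      and less: "\<forall>k. F i k (ubar(i := y)) + Ivl 0 (\<epsilon> $ k * norm (ubar i - y)) \<prec>\<^sub>C\<^sub>W F i k ubar"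
    for i y
  proof -
    define f where "f k x = F i k (ubar(i := x))" for k x
    let ?x = "ubar i" and ?N = "norm (y - ubar i)"
    obtain lam :: "real ^ 'm" and mu :: "real ^ 'p" where
      lam: "\<And>k. 0 \<le> lam $ k" "(\<Sum>k\<in>UNIV. lam $ k) = 1" and mu: "\<And>j. 0 \<le> mu $ j" and
      stat: "0 \<in> (\<Sum>k\<in>UNIV. (*\<^sub>R) (lam $ k) ` interval_clarke_gradient (f k) ?x)
            + (\<Sum>j\<in>active_set (g i) ?x. (*\<^sub>R) (mu $ j) ` clarke_gradient (g i j) ?x)
            + (\<Sum>k\<in>UNIV. (*\<^sub>R) (lam $ k * \<epsilon> $ k) ` cball 0 1)"
      using KKT[of i] unfolding nonneg_orthant_def f_def by auto
    obtain A B C where ABC: "0 = A + B + C"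
      and A: "A \<in> (\<Sum>k\<in>UNIV. (*\<^sub>R) (lam $ k) ` interval_clarke_gradient (f k) ?x)"
      and B: "B \<in> (\<Sum>j\<in>active_set (g i) ?x. (*\<^sub>R) (mu $ j) ` clarke_gradient (g i j) ?x)"
      and C: "C \<in> (\<Sum>k\<in>UNIV. (*\<^sub>R) (lam $ k * \<epsilon> $ k) ` (cball 0 1 :: (real ^ 'n) set))"
      using stat by (elim set_plus_elim) auto
    obtain \<xi> where \<xi>: "\<And>k. \<xi> k \<in> interval_clarke_gradient (f k) ?x"
        "A = (\<Sum>k\<in>UNIV. lam $ k *\<^sub>R \<xi> k)"
      using A by (rule sum_scaled_sets_elim[OF finite]) auto
    obtain \<zeta>' where \<zeta>': "\<And>j. j \<in> active_set (g i) ?x \<Longrightarrow> \<zeta>' j \<in> clarke_gradient (g i j) ?x"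
        "B = (\<Sum>j\<in>active_set (g i) ?x. mu $ j *\<^sub>R \<zeta>' j)"
      using B by (rule sum_scaled_sets_elim[OF finite]) blast
    obtain \<beta> :: "'m \<Rightarrow> real ^ 'n" where \<beta>: "\<And>k. \<beta> k \<in> cball 0 1"
        "C = (\<Sum>k\<in>UNIV. (lam $ k * \<epsilon> $ k) *\<^sub>R \<beta> k)"
      using C by (rule sum_scaled_sets_elim[OF finite]) auto
    \<comment> \<open>Stationarity supplies gradients for active constraints only; the remaining
      ones are filled in arbitrarily, since generalized convexity takes one for each
      \<open>j\<close>.\<close>
    have "\<exists>\<zeta>. \<forall>j. \<zeta> j \<in> clarke_gradient (g i j) ?x
                \<and> (j \<in> active_set (g i) ?x \<longrightarrow> \<zeta> j = \<zeta>' j)"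
      using \<zeta>'(1) clarke_gradient_nonempty[OF g_lipschitz] by (intro choice) blast
    then obtain \<zeta> where \<zeta>: "\<And>j. \<zeta> j \<in> clarke_gradient (g i j) ?x"
      "\<And>j. j \<in> active_set (g i) ?x \<Longrightarrow> \<zeta> j = \<zeta>' j" by blast
    have gc: "generalized_convex_at f (g i) ?x"
      using gen_convex[of i] by (simp add: f_def[abs_def])
    have y': "y \<in> strategy_set (g i)" using y S_eq by simp
    obtain v where v\<xi>: "\<And>k. \<xi> k \<bullet> v \<le> center (f k y) - center (f k ?x)
                              + halfwidth (f k y) - halfwidth (f k ?x)"
      and v\<zeta>: "\<And>j. \<zeta> j \<bullet> v \<le> g i j y - g i j ?x"
      and v\<beta>: "\<And>b. b \<in> cball 0 1 \<Longrightarrow> b \<bullet> v \<le> ?N"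
      using gc[unfolded generalized_convex_at_def, rule_format, OF y' \<xi>(1) \<zeta>(1)] by blast
    have eps_nonneg: "0 \<le> \<epsilon> $ k" for k using eps by (simp add: nonneg_orthant_def)
    have lt: "\<xi> k \<bullet> v < - (\<epsilon> $ k * ?N)" for k
      using prec_CW_add_Ivl_zero[OF less[rule_format, of k]] v\<xi>[of k]
      by (simp add: f_def norm_minus_commute)
    \<comment> \<open>For an active constraint the value at \<open>?x\<close> is 0 and the value at
      the feasible \<open>y\<close> is at most 0.\<close>
    have "B \<bullet> v = (\<Sum>j\<in>active_set (g i) ?x. mu $ j * (\<zeta> j \<bullet> v))"
      using \<zeta>(2) by (simp add: \<zeta>'(2) inner_sum_left)
    also have "\<dots> \<le> 0"
    proof (intro sum_nonpos mult_nonneg_nonpos mu)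
      fix j assume "j \<in> active_set (g i) ?x"
      then show "\<zeta> j \<bullet> v \<le> 0"
        using v\<zeta>[of j] y' by (simp add: active_set_def strategy_set_def) (meson order_trans)
    qed
    finally have Bv: "B \<bullet> v \<le> 0" .
    \<comment> \<open>The weights sum to 1, so one is positive; it keeps the total strictly
      negative.\<close>
    obtain k0 where "lam $ k0 \<noteq> 0" using lam(2) by (metis sum.neutral zero_neq_one)
    then have k0: "0 < lam $ k0" using lam(1)[of k0] by simp
    \<comment> \<open>\<open>A\<close> and \<open>C\<close> carry the same weights
      \<open>lam\<close>, so they are paired term by term: the ball term adds at most
      \<open>\<epsilon> $ k * ?N\<close>, which the strict decrease in \<open>lt\<close>
      outweighs.\<close>
    have "(A + C) \<bullet> v = (\<Sum>k\<in>UNIV. lam $ k * (\<xi> k \<bullet> v + \<epsilon> $ k * (\<beta> k \<bullet> v)))"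
      by (simp add: \<xi>(2) \<beta>(2) inner_add_left inner_sum_left sum.distrib algebra_simps)
    also have "\<dots> < (\<Sum>k\<in>(UNIV :: 'm set). 0)"
    proof (rule sum_strict_mono_ex1)
      have neg: "\<xi> k \<bullet> v + \<epsilon> $ k * (\<beta> k \<bullet> v) < 0" for k
        using lt[of k] mult_left_mono[OF v\<beta>[OF \<beta>(1)[of k]] eps_nonneg[of k]] by linarith
      show "\<forall>k\<in>UNIV. lam $ k * (\<xi> k \<bullet> v + \<epsilon> $ k * (\<beta> k \<bullet> v)) \<le> 0"
        using neg lam(1) by (simp add: mult_nonneg_nonpos less_imp_le)
      show "\<exists>k\<in>UNIV. lam $ k * (\<xi> k \<bullet> v + \<epsilon> $ k * (\<beta> k \<bullet> v)) < 0"
        using neg k0 by (meson UNIV_I mult_pos_neg)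
    qed simp
    finally have "(A + B + C) \<bullet> v < 0" using Bv by (simp add: inner_add_left)
    then show False using ABC by simp
  qed
  then show ?thesis using ubar unfolding weak_quasi_nash_def by blast
qed

end
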